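(* Let $J\subset\mathbb{R}$ be connected and let $k\in\mathcal{K}$. Then the family $\mathfrak{F}[k]=\{\mathfrak{F}_\alpha[k]\}_{\alpha\in J}$ is a filtration of $\mathcal{G}_0$. If, in addition, for some $\gamma\in J$ we have $k(\gamma,r)\ge \frac{1+r^2}{1-r^2}$ for all $r\in[0,1)$, then $\mathfrak{F}_\gamma[k]=\mathcal{G}_0$.
   Context: Let $\mathbb{D}$ be the open unit disk in $\mathbb{C}$. $\mathcal{A}$ is the set of holomorphic $f:\mathbb{D}\to\mathbb{C}$ with $f(0)=0$, $f'(0)=1$. $\mathcal{P}$ is the set of holomorphic $q:\mathbb{D}\to\mathbb{C}$ with $q(0)=1$ and $\operatorname{Re}q>0$ on $\mathbb{D}$. $\mathcal{G}_0=\{f\in\mathcal{A}: f(z)/z\in\mathcal{P}\}$ (with $f(z)/z$ extended by its limit at $0$). $J$ is a connected subset of $\mathbb{R}$. A filtration of $\mathcal{G}_0$ is a family $\{\mathfrak{F}_s\}_{s\in J}$ of subsets $\mathfrak{F}_s\subseteq\mathcal{G}_0$ such that $\mathfrak{F}_s\subseteq\mathfrak{F}_t$ whenever $s,t\in J$, $s\le t$. $\mathcal{K}$ is the set of all functions $k:J\times[0,1)\to[-1,+\infty)$ such that for every $r\in[0,1)$ the function $k(\cdot,r)$ is non-decreasing on $J$. For $k\in\mathcal{K}$ and $\alpha\in J$, $$\mathfrak{F}_\alpha[k]=\left\{f\in\mathcal{A}:\ \operatorname{Re}\left[k(\alpha,|z|)\frac{f(z)}{z}+f'(z)\right]\ge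 0\ \text{ for all } z\in\mathbb{D}\setminus\{0\}\right\}.$$ *)

theory Defs
  imports "HOL-Complex_Analysis.Complex_Analysis"
begin

text \<open>
  Functions on the unit disk are total functions of type \<open>complex \<Rightarrow> complex\<close>. All the classes
  below depend only on the values on the disk: membership is not affected by the values
  outside it.
\<close>

abbreviation unit_disk :: "complex set"
  where "unit_disk \<equiv> ball 0 1"

definition class_A :: "(complex \<Rightarrow> complex) set"
  where "class_A = {f. f holomorphic_on unit_disk \<and> f 0 = 0 \<and> deriv f 0 = 1}"

definition class_P :: "(complex \<Rightarrow> complex) set"
  where "class_P = {q. q holomorphic_on unit_disk \<and> q 0 = 1 \<and> (\<forall>z\<in>unit_disk. Re (q z) > 0)}"

definition quot_ext :: "(complex \<Rightarrow> complex) \<Rightarrow> complex \<Rightarrow> complex"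
  where "quot_ext f z = (if z = 0 then Lim (at 0) (\<lambda>w. f w / w) else f z / z)"

definition class_G0 :: "(complex \<Rightarrow> complex) set"
  where "class_G0 = {f \<in> class_A. quot_ext f \<in> class_P}"

definition filtration_G0 :: "real set \<Rightarrow> (real \<Rightarrow> (complex \<Rightarrow> complex) set) \<Rightarrow> bool"
  where "filtration_G0 J F \<longleftrightarrow>
    connected J \<and> (\<forall>s\<in>J. F s \<subseteq> class_G0) \<and> (\<forall>s\<in>J. \<forall>t\<in>J. s \<le> t \<longrightarrow> F s \<subseteq> F t)"

text \<open>The values of \<open>k\<close> outside \<open>J \<times> [0,1)\<close> are irrelevant.\<close>

definition class_K :: "real set \<Rightarrow> (real \<Rightarrow> real \<Rightarrow> real) set"
  where "class_K J = {k. (\<forall>\<alpha>\<in>J. \<forall>r\<in>{0..<1}. k \<alpha> r \<ge> -1) \<and>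
                         (\<forall>r\<in>{0..<1}. mono_on J (\<lambda>\<alpha>. k \<alpha> r))}"

definition filt_set :: "(real \<Rightarrow> real \<Rightarrow> real) \<Rightarrow> real \<Rightarrow> (complex \<Rightarrow> complex) set"
  where "filt_set k \<alpha> = {f \<in> class_A. \<forall>z \<in> unit_disk - {0}.
           Re (complex_of_real (k \<alpha> (cmod z)) * (f z / z) + deriv f z) \<ge> 0}"

end

theory Submission
  imports Defs
begin

text \<open>
  Put \<open>q(z) = f(z)/z\<close>, so that \<open>f' = q + z q'\<close> and the defining inequality reads
  \<open>Re ((k + 1) q + z q') \<ge> 0\<close>. Along a radius, \<open>u(r) = Re q(r e\<^sup>i\<^sup>\<theta>)\<close> has \<open>r u'(r) = Re (z q'(z))\<close>;
  as \<open>k + 1 \<ge> 0\<close>, the function \<open>u\<close> is nondecreasing wherever it is negative, and \<open>u(0) = 1\<close>, so it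
  never becomes negative. The open mapping theorem improves \<open>Re q \<ge> 0\<close> to \<open>Re q > 0\<close>, and
  monotonicity in the parameter follows at once. For the equality, Schwarz--Pick for the right
  half-plane gives \<open>|q'(z)| \<le> 2 Re q(z) / (1 - |z|\<^sup>2)\<close>, while
  \<open>k + 1 \<ge> 2 / (1 - |z|\<^sup>2)\<close>.
\<close>

section \<open>Positivity of real parts: the radial argument and the open mapping argument\<close>

lemma nonneg_if_nondecreasing_where_negative:
  fixes u :: "real \<Rightarrow> real"
  assumes "a \<le> b" and cont: "continuous_on {a..b} u" and "u a \<ge> 0"
    and der: "\<And>x. a < x \<Longrightarrow> x < b \<Longrightarrow> u x < 0 \<Longrightarrow> \<exists>y. DERIV u x :> y \<and> y \<ge> 0"
  shows "u b \<ge> 0"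
proof (rule ccontr)
  assume neg: "\<not> u b \<ge> 0"
  \<comment> \<open>The largest element \<open>c\<close> of this compact set is the last point where
    \<open>u\<close> is nonnegative. Beyond \<open>c\<close> the function is negative, hence
    nondecreasing, so \<open>u b\<close> cannot fall below \<open>u c\<close>.\<close>
  define S where "S = {a..b} \<inter> u -` {0..}"
  have "closed S"
    unfolding S_def by (intro continuous_closed_preimage cont) auto
  then have "compact S"
    unfolding compact_eq_bounded_closed
    by (metis S_def bounded_closed_interval bounded_subset inf_le1)
  moreover have "a \<in> S"
    using assms by (auto simp: S_def)
  ultimately obtain c where c: "c \<in> S" and sup: "\<And>x. x \<in> S \<Longrightarrow> x \<le> c"
    using compact_attains_sup[of S] by blast
  have "a \<le> c" "c \<le> b" "u c \<ge> 0"
    using c by (auto simp: S_def)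
  have "u c \<le> u b"
  proof (rule DERIV_nonneg_imp_increasing_open[OF \<open>c \<le> b\<close>])
    show "continuous_on {c..b} u"
      using cont by (rule continuous_on_subset) (use \<open>a \<le> c\<close> in auto)
  next
    fix x assume x: "c < x" "x < b"
    with sup[of x] \<open>a \<le> c\<close> have "u x < 0"
      by (force simp: S_def)
    then show "\<exists>y. DERIV u x :> y \<and> y \<ge> 0"
      using der x \<open>a \<le> c\<close> by auto
  qed
  with neg \<open>u c \<ge> 0\<close> show False by simp
qed

lemma Re_nonneg_if_radially_controlled:
  fixes q :: "complex \<Rightarrow> complex" and c :: "complex \<Rightarrow> real"
  assumes hol: "q holomorphic_on unit_disk" and "Re (q 0) \<ge> 0"
    and ineq: "\<And>z. z \<in> unit_disk - {0} \<Longrightarrow> c z * Re (q z) + Re (z * deriv q z) \<ge> 0"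
    and c: "\<And>z. z \<in> unit_disk \<Longrightarrow> c z \<ge> 0"
    and z: "z \<in> unit_disk"
  shows "Re (q z) \<ge> 0"
proof -
  \<comment> \<open>The segment from 0 to \<open>z\<close> is parametrised by \<open>t\<close> in
    [0,1] instead of by the modulus, so \<open>z\<close> need not be written in polar form and
    \<open>u 1\<close> is the target value.\<close>
  define u where "u = (\<lambda>t::real. Re (q (of_real t * z)))"
  have in_disk: "of_real t * z \<in> unit_disk" if "t \<in> {0..1}" for t :: real
  proof -
    have "\<bar>t\<bar> * norm z \<le> 1 * norm z"
      using that by (intro mult_right_mono) auto
    then show ?thesis using z by (simp add: norm_mult)
  qed
  have deriv_u: "DERIV u t :> Re (z * deriv q (of_real t * z))" if "t \<in> {0..1}" for t
  proof -
    have "(q has_field_derivative deriv q (of_real t * z)) (at (of_real t * z))"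
      using hol in_disk[OF that] by (intro holomorphic_derivI[of q unit_disk]) auto
    then have "((\<lambda>w. q (w * z)) has_field_derivative deriv q (of_real t * z) * z) (at (of_real t))"
      by (rule DERIV_chain2) (auto intro!: derivative_eq_intros)
    then have "((\<lambda>t::real. q (of_real t * z)) has_vector_derivative deriv q (of_real t * z) * z) (at t)"
      by (rule has_vector_derivative_real_field)
    from has_field_derivative_Re[OF this] show ?thesis
      by (simp add: u_def mult.commute)
  qed
  have "u 1 \<ge> 0"
  proof (rule nonneg_if_nondecreasing_where_negative[of 0 1])
    show "continuous_on {0..1} u"
      using deriv_u by (meson DERIV_isCont continuous_at_imp_continuous_on)
    show "u 0 \<ge> 0"
      using assms(2) by (simp add: u_def)
  next
    fix t :: real assume t: "0 < t" "t < 1" "u t < 0"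
    define w where "w = of_real t * z"
    \<comment> \<open>\<open>w = 0\<close> would give \<open>u t = Re (q 0)\<close>, which is
      nonnegative, against \<open>u t < 0\<close>.\<close>
    have "w \<noteq> 0"
      using t assms(2) by (auto simp: w_def u_def)
    have "w \<in> unit_disk"
      using in_disk[of t] t by (simp add: w_def)
    \<comment> \<open>The hypothesis is used at \<open>w\<close>; the factor \<open>t\<close> comes
      from \<open>w = t * z\<close>.\<close>
    have "0 \<le> c w * u t + t * Re (z * deriv q w)"
      using ineq[of w] \<open>w \<noteq> 0\<close> \<open>w \<in> unit_disk\<close> by (simp add: w_def u_def algebra_simps)
    moreover have "c w * u t \<le> 0"
      using c[OF \<open>w \<in> unit_disk\<close>] t by (simp add: mult_nonneg_nonpos)
    ultimately have "Re (z * deriv q w) \<ge> 0"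
      using t by (smt (verit) mult_pos_neg)
    then show "\<exists>y. DERIV u t :> y \<and> y \<ge> 0"
      using deriv_u[of t] t by (auto simp: w_def)
  qed simp
  then show ?thesis by (simp add: u_def)
qed

text \<open>A nonconstant \<open>q\<close> has an open image, so a value on the imaginary axis would
  force values to the left of it. A constant \<open>q\<close> takes the value \<open>q a\<close>
  everywhere.\<close>

lemma holomorphic_Re_nonneg_imp_pos:
  fixes q :: "complex \<Rightarrow> complex"
  assumes hol: "q holomorphic_on S" and "open S" "connected S"
    and nonneg: "\<And>z. z \<in> S \<Longrightarrow> Re (q z) \<ge> 0"
    and a: "a \<in> S" "Re (q a) > 0" and z: "z \<in> S"
  shows "Re (q z) > 0"
proof (cases "q constant_on S")
  case True
  then show ?thesis using a z by (auto simp: constant_on_def)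
next
  case False
  then have "open (q ` S)"
    using open_mapping_thm[OF hol \<open>open S\<close> \<open>connected S\<close> \<open>open S\<close>] by blast
  then obtain e where "e > 0" and e: "ball (q z) e \<subseteq> q ` S"
    using z by (meson image_eqI openE)
  have "q z - of_real (e / 2) \<in> ball (q z) e"
    using \<open>e > 0\<close> by (simp add: dist_norm)
  with e obtain w where "w \<in> S" "q w = q z - of_real (e / 2)"
    by (metis imageE subsetD)
  with nonneg[of w] \<open>e > 0\<close> show ?thesis by simp
qed

section \<open>Schwarz--Pick estimate for the right half-plane\<close>

lemma Schwarz_Pick_right_half_plane:
  fixes q :: "complex \<Rightarrow> complex"
  assumes hol: "q holomorphic_on unit_disk"
    and pos: "\<And>z. z \<in> unit_disk \<Longrightarrow> Re (q z) > 0"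
    and a: "a \<in> unit_disk"
  shows "norm (deriv q a) * (1 - (norm a)\<^sup>2) \<le> 2 * Re (q a)"
proof -
  \<comment> \<open>The parameter is \<open>- a\<close> because the disk automorphism needed is the
    one taking 0 to \<open>a\<close>, namely \<open>(z + a) / (1 + cnj a * z)\<close>.\<close>
  define m where "m = Moebius_function 0 (- a)"
  \<comment> \<open>After \<open>q\<close>, a Cayley map sends the right half-plane to the disk and
    \<open>q a\<close> to 0. Thus \<open>h\<close> is a self-map of the disk fixing 0, and the
    Schwarz lemma bounds its derivative there.\<close>
  define h where "h = (\<lambda>z. (q (m z) - q a) / (q (m z) + cnj (q a)))"
  have m_hol: "m holomorphic_on unit_disk"
    using a by (simp add: m_def Moebius_function_holomorphic)
  have m_disk: "m z \<in> unit_disk" if "z \<in> unit_disk" for z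
    using a that by (simp add: m_def Moebius_function_norm_lt_1)
  have m0: "m 0 = a"
    by (simp add: m_def Moebius_function_of_zero)
  have denom: "q w + cnj (q a) \<noteq> 0" if "w \<in> unit_disk" for w
    using pos[OF that] pos[OF a] by (auto simp: complex_eq_iff)
  have qm_hol: "(\<lambda>z. q (m z)) holomorphic_on unit_disk"
    using holomorphic_on_compose_gen[OF m_hol hol] m_disk unfolding o_def by blast
  have h_hol: "h holomorphic_on unit_disk"
    unfolding h_def using qm_hol m_disk denom by (intro holomorphic_intros) auto
  have h_disk: "norm (h z) < 1" if "norm z < 1" for z
  proof -
    have w: "m z \<in> unit_disk"
      using m_disk that by simp
    \<comment> \<open>The point \<open>- cnj (q a)\<close> is the mirror image of \<open>q a\<close>
      in the imaginary axis; the identity shows that points of the right half-plane are closer to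
      \<open>q a\<close> than to that image.\<close>
    have "(norm (q (m z) - q a))\<^sup>2 + 4 * Re (q (m z)) * Re (q a) = (norm (q (m z) + cnj (q a)))\<^sup>2"
      unfolding cmod_power2 by (simp add: power2_eq_square algebra_simps)
    moreover have "Re (q (m z)) * Re (q a) > 0"
      using pos[OF w] pos[OF a] by simp
    ultimately have "(norm (q (m z) - q a))\<^sup>2 < (norm (q (m z) + cnj (q a)))\<^sup>2"
      by linarith
    then have "norm (q (m z) - q a) < norm (q (m z) + cnj (q a))"
      by (rule power2_less_imp_less) simp
    then show ?thesis
      using denom[OF w] by (simp add: h_def norm_divide)
  qed
  have "norm (deriv h 0) \<le> 1"
    by (rule Schwarz_Lemma(2)[OF h_hol, of 0]) (use h_disk m0 in \<open>auto simp: h_def\<close>)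
  moreover have "deriv h 0 = deriv q a * of_real (1 - (norm a)\<^sup>2) / of_real (2 * Re (q a))"
  proof -
    have "(m has_field_derivative 1 - (norm a)\<^sup>2) (at 0)"
      unfolding m_def Moebius_function_simple
      by (auto intro!: derivative_eq_intros simp: mult.commute simp flip: complex_norm_square)
    moreover have "(q has_field_derivative deriv q a) (at (m 0))"
      using hol a by (auto simp: m0 intro!: holomorphic_derivI)
    ultimately have "((\<lambda>z. q (m z)) has_field_derivative deriv q a * (1 - (norm a)\<^sup>2)) (at 0)"
      by (rule DERIV_chain2[rotated])
    \<comment> \<open>The numerator of \<open>h\<close> vanishes at 0, so only its own derivative
      survives in the quotient rule.\<close>
    then have "(h has_field_derivative deriv q a * (1 - (norm a)\<^sup>2) / (q a + cnj (q a))) (at 0)"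
      unfolding h_def using denom[OF a]
      by (auto intro!: derivative_eq_intros simp: m0)
    then show ?thesis
      by (simp add: DERIV_imp_deriv complex_add_cnj)
  qed
  moreover have "(norm a)\<^sup>2 < 1"
    using a by (simp add: abs_square_less_1)
  ultimately show ?thesis
    using pos[OF a] by (simp add: norm_mult norm_divide divide_le_eq del: of_real_diff of_real_mult)
qed

section \<open>The quotient f(z)/z and the classes expressed through it\<close>

lemma quot_ext_0:
  assumes "f \<in> class_A"
  shows "quot_ext f 0 = 1"
proof -
  have "(f has_field_derivative 1) (at 0)"
    using assms holomorphic_derivI[of f unit_disk 0] by (auto simp: class_A_def)
  then have "((\<lambda>w. f w / w) \<longlongrightarrow> 1) (at 0)"
    using assms by (simp add: has_field_derivative_iff class_A_def)
  then show ?thesis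
    by (simp add: quot_ext_def tendsto_Lim)
qed

lemma class_A_eq_times_quot_ext:
  assumes "f \<in> class_A"
  shows "f z = z * quot_ext f z"
  using assms by (simp add: quot_ext_def class_A_def)

text \<open>The singularity at 0 is removable: the value 1 assigned there equals
  \<open>deriv f 0\<close>.\<close>

lemma quot_ext_holomorphic:
  assumes "f \<in> class_A"
  shows "quot_ext f holomorphic_on unit_disk"
proof (rule pole_theorem_open_0[of f _ 0])
  show "f z = (z - 0) * quot_ext f z" for z
    using class_A_eq_times_quot_ext[OF assms] by simp
  show "quot_ext f 0 = deriv f 0"
    using quot_ext_0[OF assms] assms by (simp add: class_A_def)
qed (use assms in \<open>auto simp: class_A_def\<close>)

lemma deriv_class_A:
  assumes "f \<in> class_A" "z \<in> unit_disk"
  shows "deriv f z = quot_ext f z + z * deriv (quot_ext f) z"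
proof -
  have "(quot_ext f has_field_derivative deriv (quot_ext f) z) (at z)"
    using quot_ext_holomorphic[OF assms(1)] assms(2) by (intro holomorphic_derivI[of _ unit_disk]) auto
  then have "((\<lambda>z. z * quot_ext f z) has_field_derivative quot_ext f z + z * deriv (quot_ext f) z) (at z)"
    by (auto intro!: derivative_eq_intros)
  \<comment> \<open>The factorization holds at every complex \<open>z\<close>, off the disk too, so
    this is an equality of total functions and \<open>deriv\<close> can be rewritten with
    it.\<close>
  moreover have "(\<lambda>z. z * quot_ext f z) = f"
    using class_A_eq_times_quot_ext[OF assms(1)] by auto
  ultimately show ?thesis
    by (simp add: DERIV_imp_deriv)
qed

lemma filt_set_iff:
  "f \<in> filt_set k \<alpha> \<longleftrightarrow> f \<in> class_A \<and> (\<forall>z \<in> unit_disk - {0}.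
     (k \<alpha> (norm z) + 1) * Re (quot_ext f z) + Re (z * deriv (quot_ext f) z) \<ge> 0)"
proof (cases "f \<in> class_A")
  case True
  have "Re (complex_of_real (k \<alpha> (norm z)) * (f z / z) + deriv f z) =
      (k \<alpha> (norm z) + 1) * Re (quot_ext f z) + Re (z * deriv (quot_ext f) z)"
    if "z \<in> unit_disk - {0}" for z
  proof -
    have "f z / z = quot_ext f z"
      using that by (simp add: quot_ext_def)
    then show ?thesis
      using that deriv_class_A[OF True, of z] by (simp add: algebra_simps)
  qed
  with True show ?thesis
    by (simp add: filt_set_def)
qed (simp add: filt_set_def)

lemma class_G0_iff:
  "f \<in> class_G0 \<longleftrightarrow> f \<in> class_A \<and> (\<forall>z\<in>unit_disk. Re (quot_ext f z) > 0)"
  using quot_ext_0 quot_ext_holomorphic by (auto simp: class_G0_def class_P_def)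

section \<open>Inclusions between the filtration sets and \<open>class_G0\<close>\<close>

lemma filt_set_subset_G0:
  assumes "\<And>r. r \<in> {0..<1} \<Longrightarrow> k \<alpha> r \<ge> -1"
  shows "filt_set k \<alpha> \<subseteq> class_G0"
proof
  fix f assume f: "f \<in> filt_set k \<alpha>"
  then have A: "f \<in> class_A"
    by (simp add: filt_set_iff)
  note hol = quot_ext_holomorphic[OF A]
  have nonneg: "Re (quot_ext f z) \<ge> 0" if "z \<in> unit_disk" for z
  proof (rule Re_nonneg_if_radially_controlled[OF hol _ _ _ that])
    show "Re (quot_ext f 0) \<ge> 0"
      by (simp add: quot_ext_0[OF A])
    show "(k \<alpha> (norm w) + 1) * Re (quot_ext f w) + Re (w * deriv (quot_ext f) w) \<ge> 0"
      if "w \<in> unit_disk - {0}" for w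
      using f that by (simp add: filt_set_iff)
    show "k \<alpha> (norm w) + 1 \<ge> 0" if "w \<in> unit_disk" for w
      using assms[of "norm w"] that by simp
  qed
  \<comment> \<open>Strictness comes from the value 1 of the quotient at 0.\<close>
  have "Re (quot_ext f z) > 0" if "z \<in> unit_disk" for z
    by (rule holomorphic_Re_nonneg_imp_pos[OF hol _ _ nonneg, of 0])
      (use that quot_ext_0[OF A] in auto)
  with A show "f \<in> class_G0"
    by (simp add: class_G0_iff)
qed

text \<open>Membership in \<open>class_G0\<close> makes the real part of the quotient positive; only
  then does a larger coefficient increase the left-hand side.\<close>

lemma filt_set_mono:
  assumes sub: "filt_set k s \<subseteq> class_G0" and le: "\<And>r. r \<in> {0..<1} \<Longrightarrow> k s r \<le> k t r"
  shows "filt_set k s \<subseteq> filt_set k t"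
proof
  fix f assume f: "f \<in> filt_set k s"
  with sub have G0: "f \<in> class_G0" by blast
  have "(k t (norm z) + 1) * Re (quot_ext f z) + Re (z * deriv (quot_ext f) z) \<ge> 0"
    if z: "z \<in> unit_disk - {0}" for z
  proof -
    have "(k s (norm z) + 1) * Re (quot_ext f z) \<le> (k t (norm z) + 1) * Re (quot_ext f z)"
      using G0 z le[of "norm z"] by (intro mult_right_mono) (auto simp: class_G0_iff less_imp_le)
    moreover have "(k s (norm z) + 1) * Re (quot_ext f z) + Re (z * deriv (quot_ext f) z) \<ge> 0"
      using f z unfolding filt_set_iff by blast
    ultimately show ?thesis by linarith
  qed
  with f show "f \<in> filt_set k t"
    by (simp add: filt_set_iff)
qed

lemma class_G0_subset_filt_set:
  assumes "\<And>r. r \<in> {0..<1} \<Longrightarrow> k \<gamma> r \<ge> (1 + r^2) / (1 - r^2)"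
  shows "class_G0 \<subseteq> filt_set k \<gamma>"
proof
  fix f assume G0: "f \<in> class_G0"
  then have A: "f \<in> class_A" and pos: "\<And>z. z \<in> unit_disk \<Longrightarrow> Re (quot_ext f z) > 0"
    by (auto simp: class_G0_iff)
  have "(k \<gamma> (norm z) + 1) * Re (quot_ext f z) + Re (z * deriv (quot_ext f) z) \<ge> 0"
    if z: "z \<in> unit_disk - {0}" for z
  proof -
    let ?q = "quot_ext f" and ?r = "norm z"
    have r: "?r < 1" and r2: "?r\<^sup>2 < 1"
      using z by (auto simp: abs_square_less_1)
    have "- Re (z * deriv ?q z) \<le> norm (z * deriv ?q z)"
      using abs_Re_le_cmod[of "z * deriv ?q z"] by linarith
    \<comment> \<open>The factor \<open>norm z\<close>, less than 1, is discarded.\<close>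
    also have "\<dots> \<le> norm (deriv ?q z)"
      using r by (simp add: norm_mult mult_left_le_one_le)
    also have "\<dots> \<le> 2 / (1 - ?r\<^sup>2) * Re (?q z)"
      using Schwarz_Pick_right_half_plane[OF quot_ext_holomorphic[OF A] pos, of z] z r2
      by (simp add: field_simps)
    also have "\<dots> \<le> (k \<gamma> ?r + 1) * Re (?q z)"
    proof (rule mult_right_mono)
      \<comment> \<open>This explains the threshold: it is the Schwarz--Pick factor minus the 1
        contributed by the summand \<open>q\<close> of \<open>f' = q + z q'\<close>.\<close>
      have "2 / (1 - ?r\<^sup>2) = (1 + ?r\<^sup>2) / (1 - ?r\<^sup>2) + 1"
        using r2 by (simp add: field_simps)
      then show "2 / (1 - ?r\<^sup>2) \<le> k \<gamma> ?r + 1"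
        using assms[of ?r] r by simp
      show "Re (?q z) \<ge> 0"
        using pos[of z] z by simp
    qed
    finally show ?thesis by simp
  qed
  with A show "f \<in> filt_set k \<gamma>"
    by (simp add: filt_set_iff)
qed

theorem theorem4p2:
  fixes J :: "real set" and k :: "real \<Rightarrow> real \<Rightarrow> real"
  assumes "connected J" and "k \<in> class_K J"
  shows "filtration_G0 J (filt_set k) \<and>
    (\<forall>\<gamma>\<in>J. (\<forall>r\<in>{0..<1}. k \<gamma> r \<ge> (1 + r^2) / (1 - r^2)) \<longrightarrow> filt_set k \<gamma> = class_G0)"
proof -
  have sub: "filt_set k s \<subseteq> class_G0" if "s \<in> J" for s
    using assms(2) that by (intro filt_set_subset_G0) (auto simp: class_K_def)
  have "filt_set k s \<subseteq> filt_set k t" if "s \<in> J" "t \<in> J" "s \<le> t" for s t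
    using assms(2) that by (intro filt_set_mono sub) (auto simp: class_K_def mono_on_def)
  with sub assms(1) have "filtration_G0 J (filt_set k)"
    by (simp add: filtration_G0_def)
  moreover have "filt_set k \<gamma> = class_G0"
    if "\<gamma> \<in> J" "\<forall>r\<in>{0..<1}. k \<gamma> r \<ge> (1 + r^2) / (1 - r^2)" for \<gamma>
    using sub[OF that(1)] class_G0_subset_filt_set[of k \<gamma>] that(2) by blast
  ultimately show ?thesis by blast
qed

end
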